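(* Let $\mathcal H=(V,H)$ be a hypergraph. Then $\Theta(\mathcal H)\cong AD(I(\mathcal H))$.
   Context: A hypergraph $\mathcal H=(V,H)$ is a nonempty set $V$ of vertices together with a collection $H$ of subsets of $V$, called hyperedges. $\Theta(\mathcal H)$ is the simplicial complex whose simplices are spanned by all finite subsets of complements $V\setminus h$ of hyperedges $h\in H$. The independence complex $I(\mathcal H)$ is the simplicial complex whose simplices are the collections of vertices from $V$ that contain no hyperedge. For a simplicial complex $X$ with vertex set $V$, the Alexander dual $AD(X)$ has as simplices those $\sigma\subset V$ such that $V\setminus\sigma$ is not a simplex of $X$. Here the Alexander dual of $I(\mathcal H)$ is taken with respect to the full vertex set $V$ of $\mathcal H$. *)

theory Defs
  imports Main
begin

definition hypergraph :: "'a set \<Rightarrow> 'a set set \<Rightarrow> bool" where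
  "hypergraph V H \<longleftrightarrow> V \<noteq> {} \<and> (\<forall>h\<in>H. h \<subseteq> V)"

text \<open>
  A complex is represented by the family of its simplices. The empty set counts as a
  simplex, except in the void complex \<open>{}\<close>; Alexander duality needs this convention, since
  \<open>V\<close> is a simplex of the dual of \<open>X\<close> iff the empty set is not a simplex of \<open>X\<close>.
\<close>

definition abstract_simplicial_complex :: "'a set set \<Rightarrow> bool" where
  "abstract_simplicial_complex K \<longleftrightarrow>
     (\<forall>\<sigma>\<in>K. finite \<sigma>) \<and> (\<forall>\<sigma>\<in>K. \<forall>\<tau>. \<tau> \<subseteq> \<sigma> \<longrightarrow> \<tau> \<in> K)"

definition simplicial_isomorphism :: "('a \<Rightarrow> 'b) \<Rightarrow> 'a set set \<Rightarrow> 'b set set \<Rightarrow> bool" where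
  "simplicial_isomorphism f K L \<longleftrightarrow>
     bij_betw f (\<Union>K) (\<Union>L) \<and> (\<forall>\<sigma>. \<sigma> \<subseteq> \<Union>K \<longrightarrow> (\<sigma> \<in> K \<longleftrightarrow> f ` \<sigma> \<in> L))"

definition simplicially_isomorphic :: "'a set set \<Rightarrow> 'b set set \<Rightarrow> bool" where
  "simplicially_isomorphic K L \<longleftrightarrow> (\<exists>f. simplicial_isomorphism f K L)"

definition Theta_complex :: "'a set \<Rightarrow> 'a set set \<Rightarrow> 'a set set" where
  "Theta_complex V H = {\<sigma>. finite \<sigma> \<and> (\<exists>h\<in>H. \<sigma> \<subseteq> V - h)}"

text \<open>
  The vertex set is allowed to be infinite. The members of the independence complex are then
  all independent collections, finite or not: the Alexander dual tests cofinite sets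
  \<open>V - \<sigma>\<close> for membership, so discarding the infinite independent collections would make
  every finite \<open>\<sigma>\<close> a simplex of the dual. The dual itself consists of finite sets, as any
  simplicial complex. For finite \<open>V\<close> both points are vacuous.
\<close>

definition independence_complex :: "'a set \<Rightarrow> 'a set set \<Rightarrow> 'a set set" where
  "independence_complex V H = {\<sigma>. \<sigma> \<subseteq> V \<and> \<not> (\<exists>h\<in>H. h \<subseteq> \<sigma>)}"

definition Alexander_dual :: "'a set \<Rightarrow> 'a set set \<Rightarrow> 'a set set" where
  "Alexander_dual V X = {\<sigma>. finite \<sigma> \<and> \<sigma> \<subseteq> V \<and> V - \<sigma> \<notin> X}"

lemma abstract_simplicial_complex_Theta:
  "abstract_simplicial_complex (Theta_complex V H)"
  unfolding abstract_simplicial_complex_def Theta_complex_def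
  by (blast intro: finite_subset)

lemma independence_complex_subset_closed:
  "\<sigma> \<in> independence_complex V H \<Longrightarrow> \<tau> \<subseteq> \<sigma> \<Longrightarrow> \<tau> \<in> independence_complex V H"
  unfolding independence_complex_def by blast

lemma abstract_simplicial_complex_independence:
  "finite V \<Longrightarrow> abstract_simplicial_complex (independence_complex V H)"
  unfolding abstract_simplicial_complex_def independence_complex_def
  by (blast intro: finite_subset)

lemma abstract_simplicial_complex_Alexander_dual:
  assumes "\<And>\<sigma> \<tau>. \<sigma> \<in> X \<Longrightarrow> \<tau> \<subseteq> \<sigma> \<Longrightarrow> \<tau> \<in> X"
  shows "abstract_simplicial_complex (Alexander_dual V X)"
  unfolding abstract_simplicial_complex_def Alexander_dual_def
proof (intro conjI ballI allI impI)
  fix \<sigma> \<tau> assume s: "\<sigma> \<in> {\<sigma>. finite \<sigma> \<and> \<sigma> \<subseteq> V \<and> V - \<sigma> \<notin> X}" and t: "\<tau> \<subseteq> \<sigma>"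
  have "V - \<sigma> \<subseteq> V - \<tau>" using t by blast
  then show "\<tau> \<in> {\<sigma>. finite \<sigma> \<and> \<sigma> \<subseteq> V \<and> V - \<sigma> \<notin> X}"
    using s t assms[of "V - \<tau>" "V - \<sigma>"] by (auto intro: finite_subset)
qed auto

end

theory Submission
  imports Defs
begin

text \<open>
  The two complexes are equal, so the identity on vertices is an isomorphism. Both
  \<open>\<sigma> \<subseteq> V - h\<close> and \<open>h \<subseteq> V - \<sigma>\<close> say that \<open>\<sigma>\<close> and \<open>h\<close> are disjoint subsets of \<open>V\<close>,
  once \<open>\<sigma>, h \<subseteq> V\<close>. Quantified over the hyperedges, the first describes the simplices of
  \<open>\<Theta>\<close>, and the second says that \<open>V - \<sigma>\<close> fails to be independent.
\<close>

lemma Theta_complex_eq_Alexander_dual: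
  assumes "\<And>h. h \<in> H \<Longrightarrow> h \<subseteq> V"
  shows "Theta_complex V H = Alexander_dual V (independence_complex V H)"
proof (rule set_eqI)
  fix \<sigma> :: "'a set"
  have "\<sigma> \<subseteq> V - h \<longleftrightarrow> \<sigma> \<subseteq> V \<and> h \<subseteq> V - \<sigma>" if "h \<in> H" for h
    using assms[OF that] by (auto simp only: Diff_iff subset_iff)
  then have "(\<exists>h\<in>H. \<sigma> \<subseteq> V - h) \<longleftrightarrow> \<sigma> \<subseteq> V \<and> (\<exists>h\<in>H. h \<subseteq> V - \<sigma>)"
    (is "?in_Theta \<longleftrightarrow> \<sigma> \<subseteq> V \<and> ?dependent")
    by metis
  moreover have "\<sigma> \<in> Theta_complex V H \<longleftrightarrow> finite \<sigma> \<and> ?in_Theta"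
    by (simp only: Theta_complex_def mem_Collect_eq)
  moreover have "V - \<sigma> \<in> independence_complex V H \<longleftrightarrow> \<not> ?dependent"
    by (simp only: independence_complex_def mem_Collect_eq Diff_subset simp_thms)
  ultimately show "\<sigma> \<in> Theta_complex V H \<longleftrightarrow>
      \<sigma> \<in> Alexander_dual V (independence_complex V H)"
    by (simp only: Alexander_dual_def mem_Collect_eq simp_thms)
qed

lemma simplicially_isomorphic_refl: "simplicially_isomorphic K K"
proof -
  have "simplicial_isomorphism id K K"
    by (simp add: simplicial_isomorphism_def)
  then show ?thesis
    unfolding simplicially_isomorphic_def by blast
qed

theorem proposition1:
  fixes V :: "'a set" and H :: "'a set set"
  assumes "hypergraph V H"
  shows "simplicially_isomorphic (Theta_complex V H)
           (Alexander_dual V (independence_complex V H))"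
proof -
  have "Theta_complex V H = Alexander_dual V (independence_complex V H)"
    using assms by (intro Theta_complex_eq_Alexander_dual) (simp add: hypergraph_def)
  then show ?thesis
    by (simp add: simplicially_isomorphic_refl)
qed

end
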